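(* Let $\langle A_s : s\in\omega^{<\omega}\rangle$ be a tree partition of $\omega$, let $\mathcal H_{<\omega}=\bigcup_{n<\omega}\mathcal H_n$ be the associated nested limit ideal on $\omega$, and let $\mathrm{Fin}_\omega$ be the canonical inductive limit of the finite Fubini powers of $\mathrm{Fin}$ along suffix projections. Then $\mathrm{Fin}_\omega\not\leq_K\mathcal H_{<\omega}$.
   Context: A tree partition of $\omega$ is a family $\langle A_s:s\in\omega^{<\omega}\rangle$ of infinite subsets of $\omega$ such that $A_\varnothing=\omega$, for each $s$ the family $\{A_{s^\frown n}:n\in\omega\}$ is a partition of $A_s$, and any two distinct points of $\omega$ lie in different cells $A_s\neq A_t$ with $|s|=|t|=n$ for some $n$. For $X\subseteq\omega$ let $T^\infty_X=\{s\in\omega^{<\omega}:X\cap A_s\text{ is infinite}\}$. For $T\subseteq\omega^{<\omega}$ put $\mathrm{Succ}_T(s)=\{n:s^\frown n\in T\}$ and $D(T)=\{s\in T:\mathrm{Succ}_T(s)\text{ is infinite}\}$; $D^0(T)=T$, $D^{n+1}(T)=D(D^n(T))$. For $n<\omega$, $\mathcal H_n=\{X\subseteq\omega:\varnothing\notin D^n(T^\infty_X)\}$ (an ideal on $\omega$). $\mathrm{Fin}$ is the ideal of finite subsets of $\omega$. $\mathrm{Fin}^{\otimes1}=\mathrm{Fin}$, and $\mathrm{Fin}^{\otimes(k+1)}$ is the ideal on $\omega^{k+1}$ of all $C$ such that for all but finitely many $n$ the section $C_n=\{t\in\omega^k:(n)^\frown t\in C\}$ belongs to $\mathrm{Fin}^{\otimes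 k}$. For $k\le m$, $\pi_{k,m}:\omega^m\to\omega^k$ is the projection onto the last $k$ coordinates. $\mathrm{Fin}_\omega$ is the ideal on the disjoint sum $D=\bigsqcup_{m\ge1}\omega^m$ given by: $M\in\mathrm{Fin}_\omega$ iff there are $k\ge1$ and $B\in\mathrm{Fin}^{\otimes k}$ such that $\pi_{k,m}[M\cap\omega^m]\subseteq B$ for all $m\ge k$. For ideals $\mathcal I,\mathcal J$ on countable sets, $\mathcal I\le_K\mathcal J$ (Katětov order) means there is $f:\operatorname{dom}(\mathcal J)\to\operatorname{dom}(\mathcal I)$ with $f^{-1}[A]\in\mathcal J$ for every $A\in\mathcal I$. *)

theory Defs
  imports Main "HOL-Library.FuncSet" "HOL-Library.Disjoint_Sets"
begin

(* Finite sequences of naturals are lists, written from the first coordinate on;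
   the one-point extension of s by n at the end is "s @ [n]". *)

definition tree_partition :: "(nat list \<Rightarrow> nat set) \<Rightarrow> bool" where
  "tree_partition A \<longleftrightarrow>
     (\<forall>s. infinite (A s)) \<and>
     A [] = UNIV \<and>
     (\<forall>s. disjoint_family (\<lambda>n. A (s @ [n])) \<and> (\<Union>n. A (s @ [n])) = A s) \<and>
     (\<forall>x y. x \<noteq> y \<longrightarrow>
        (\<exists>n s t. length s = n \<and> length t = n \<and> x \<in> A s \<and> y \<in> A t \<and> A s \<noteq> A t))"

definition inf_tree :: "(nat list \<Rightarrow> nat set) \<Rightarrow> nat set \<Rightarrow> nat list set" where
  "inf_tree A X = {s. infinite (X \<inter> A s)}"

definition succ_set :: "nat list set \<Rightarrow> nat list \<Rightarrow> nat set" where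
  "succ_set T s = {n. s @ [n] \<in> T}"

definition deriv_tree :: "nat list set \<Rightarrow> nat list set" where
  "deriv_tree T = {s \<in> T. infinite (succ_set T s)}"

definition H_level :: "(nat list \<Rightarrow> nat set) \<Rightarrow> nat \<Rightarrow> nat set set" where
  "H_level A n = {X. [] \<notin> (deriv_tree ^^ n) (inf_tree A X)}"

definition H_limit :: "(nat list \<Rightarrow> nat set) \<Rightarrow> nat set set" where
  "H_limit A = (\<Union>n. H_level A n)"

definition seqs :: "nat \<Rightarrow> nat list set" where
  "seqs k = {t. length t = k}"

(* Fubini powers of Fin, as ideals on "seqs k" for k >= 1 (a natural number is
   identified with the corresponding list of length 1).  The value at 0 is a dummy. *)
fun Fin_power :: "nat \<Rightarrow> nat list set set" where
  "Fin_power 0 = {}"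
| "Fin_power (Suc 0) = {C. C \<subseteq> seqs 1 \<and> finite C}"
| "Fin_power (Suc (Suc k)) =
     {C. C \<subseteq> seqs (Suc (Suc k)) \<and>
         finite {n. {t \<in> seqs (Suc k). n # t \<in> C} \<notin> Fin_power (Suc k)}}"

definition last_proj :: "nat \<Rightarrow> nat \<Rightarrow> nat list \<Rightarrow> nat list" where
  "last_proj k m t = drop (m - k) t"

(* The sets "seqs m" are pairwise disjoint, so their union is a disjoint sum. *)
definition Fin_omega_dom :: "nat list set" where
  "Fin_omega_dom = (\<Union>m\<in>{1..}. seqs m)"

definition Fin_omega :: "nat list set set" where
  "Fin_omega = {M. M \<subseteq> Fin_omega_dom \<and>
     (\<exists>k\<ge>1. \<exists>B\<in>Fin_power k. \<forall>m\<ge>k. last_proj k m ` (M \<inter> seqs m) \<subseteq> B)}"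

(* Katetov order for I an ideal on X and J an ideal on Y. *)
definition katetov_le :: "'a set \<Rightarrow> 'a set set \<Rightarrow> 'b set \<Rightarrow> 'b set set \<Rightarrow> bool" where
  "katetov_le X I Y J \<longleftrightarrow> (\<exists>f \<in> Y \<rightarrow> X. \<forall>S\<in>I. f -` S \<inter> Y \<in> J)"

end

theory Submission
  imports Defs "HOL-Library.Countable" "HOL-Library.Infinite_Set"
begin

text \<open>
  Let \<open>f\<close> be a function from \<open>\<omega>\<close> to the finite sequences that witnesses the Katetov reduction, and let
  \<open>a\<^sub>k x\<close> be the \<open>k\<close>-th coordinate of \<open>f x\<close> counted from the right, starting with \<open>a\<^sub>0\<close>. For two adjacent
  coordinates \<open>a, b\<close> at a fixed distance from the right end, the suffix limit contains the set of all
  sequences with \<open>b \<le> h a\<close>, for every \<open>h\<close>. Hence all sets \<open>{x. a\<^sub>k x \<le> h (a\<^sub>k\<^sub>+\<^sub>1 x)}\<close> lie in the nested limit ideal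
  (\<open>reduction_gives_chain\<close>), and this alone is contradictory. The tension is that
  the Fubini powers grow by new outer coordinates, the nested ideals by new inner ones.

  Call a set large at a node \<open>s\<close> if \<open>s\<close> survives every derivative of its tree; a set is outside the
  nested limit ideal iff it is large at the root. Say that a function \<open>c\<close> is settled at level \<open>R\<close>
  if at almost all nodes \<open>t\<close> of length \<open>R\<close> (in the sense of iterated "for all but finitely many")
  some set \<open>{x. c x < j}\<close> is large. Three facts finish the proof.

  \<^item> The function \<open>a\<^sub>1\<close> is settled at some level (\<open>settled_at_some_level\<close>). Otherwise \<open>a\<^sub>1\<close> would be
    unbounded on too many cells of every level, and a fast growing \<open>h\<close> would put infinitely many points
    of each of those cells into the one set \<open>{x. a\<^sub>0 x \<le> h (a\<^sub>1 x)}\<close>.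
  \<^item> If \<open>a\<^sub>k\<close> is settled at level \<open>R + 1\<close>, then \<open>a\<^sub>k\<^sub>+\<^sub>1\<close> is settled at level \<open>R\<close> (\<open>settled_step\<close>).
  \<^item> None of the functions is settled at level 0, as \<open>{x. a\<^sub>k x < j}\<close> is in the ideal.

  So if \<open>a\<^sub>1\<close> is settled at level \<open>R\<close>, then \<open>R\<close> steps to the left make \<open>a\<^sub>R\<^sub>+\<^sub>1\<close> settled at level 0.
\<close>

section \<open>Derivatives and large sets\<close>

lemma deriv_tree_Suc_iff:
  "s \<in> (deriv_tree ^^ Suc n) T \<longleftrightarrow>
    s \<in> (deriv_tree ^^ n) T \<and> (\<exists>\<^sub>\<infinity>m. s @ [m] \<in> (deriv_tree ^^ n) T)"
  by (simp add: deriv_tree_def succ_set_def frequently_cofinite)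

lemma deriv_tree_antimono:
  assumes "m \<le> n"
  shows "(deriv_tree ^^ n) T \<subseteq> (deriv_tree ^^ m) T"
  using assms
  by (induction n rule: dec_induct) (auto simp: deriv_tree_def)

lemma deriv_tree_mono:
  assumes "T \<subseteq> U"
  shows "(deriv_tree ^^ n) T \<subseteq> (deriv_tree ^^ n) U"
proof (induction n)
  case 0
  then show ?case using assms by simp
next
  case (Suc n)
  show ?case
  proof
    fix s assume s: "s \<in> (deriv_tree ^^ Suc n) T"
    then have "\<exists>\<^sub>\<infinity>m. s @ [m] \<in> (deriv_tree ^^ n) U"
      unfolding deriv_tree_Suc_iff using Suc by (auto elim: frequently_elim1)
    with s Suc show "s \<in> (deriv_tree ^^ Suc n) U"
      unfolding deriv_tree_Suc_iff by blast
  qed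
qed

text \<open>In a downward closed tree, membership of the node itself in the previous derivative, which
  the definition of the derivative demands, is automatic.\<close>

lemma deriv_tree_SucI:
  assumes closed: "\<And>s m. s @ [m] \<in> T \<Longrightarrow> s \<in> T"
    and inf: "\<exists>\<^sub>\<infinity>m. s @ [m] \<in> (deriv_tree ^^ n) T"
  shows "s \<in> (deriv_tree ^^ Suc n) T"
  using inf
proof (induction n)
  case 0
  then have "s \<in> T" using closed by (auto dest: frequently_ex)
  with 0 show ?case unfolding deriv_tree_Suc_iff by simp
next
  case (Suc n)
  have "\<exists>\<^sub>\<infinity>m. s @ [m] \<in> (deriv_tree ^^ n) T"
    using Suc.prems by (rule frequently_elim1) (simp only: deriv_tree_Suc_iff)
  then have "s \<in> (deriv_tree ^^ Suc n) T" by (rule Suc.IH)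
  with Suc.prems show ?case by (simp only: deriv_tree_Suc_iff[of s "Suc n"])
qed

lemma inf_tree_closed:
  assumes "tree_partition A" "s @ [m] \<in> inf_tree A X"
  shows "s \<in> inf_tree A X"
proof -
  have "(\<Union>n. A (s @ [n])) = A s"
    using assms(1) unfolding tree_partition_def by blast
  then have "A (s @ [m]) \<subseteq> A s" by blast
  then have "X \<inter> A (s @ [m]) \<subseteq> X \<inter> A s" by blast
  moreover have "infinite (X \<inter> A (s @ [m]))" using assms(2) by (simp add: inf_tree_def)
  ultimately have "infinite (X \<inter> A s)" by (rule infinite_super)
  then show ?thesis by (simp add: inf_tree_def)
qed

definition large :: "(nat list \<Rightarrow> nat set) \<Rightarrow> nat set \<Rightarrow> nat list \<Rightarrow> bool" where
  "large A X s \<longleftrightarrow> (\<forall>n. s \<in> (deriv_tree ^^ n) (inf_tree A X))"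

lemma H_limit_iff_not_large: "X \<in> H_limit A \<longleftrightarrow> \<not> large A X []"
  unfolding H_limit_def H_level_def large_def by simp

lemma large_mono:
  assumes "large A X s" "X \<subseteq> Y"
  shows "large A Y s"
proof -
  have "X \<inter> A t \<subseteq> Y \<inter> A t" for t using assms(2) by blast
  then have "inf_tree A X \<subseteq> inf_tree A Y"
    unfolding inf_tree_def using infinite_super by blast
  then show ?thesis
    using assms(1) deriv_tree_mono unfolding large_def by blast
qed

lemma H_limit_subset:
  assumes "Y \<in> H_limit A" "X \<subseteq> Y"
  shows "X \<in> H_limit A"
  using assms large_mono unfolding H_limit_iff_not_large by blast

lemma large_imp_infinite:
  assumes "large A X s"
  shows "infinite (X \<inter> A s)"
proof -
  have "s \<in> (deriv_tree ^^ 0) (inf_tree A X)" using assms unfolding large_def by blast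
  then show ?thesis by (simp add: inf_tree_def)
qed

lemma large_UNIV:
  assumes "tree_partition A"
  shows "large A UNIV s"
proof -
  have "inf_tree A UNIV = UNIV"
    using assms by (simp add: inf_tree_def tree_partition_def)
  then have "(deriv_tree ^^ n) (inf_tree A UNIV) = UNIV" for n
    by (induction n) (auto simp: deriv_tree_def succ_set_def)
  then show ?thesis unfolding large_def by simp
qed

lemma large_if_frequently_large:
  assumes "tree_partition A" "\<exists>\<^sub>\<infinity>n. large A X (s @ [n])"
  shows "large A X s"
  unfolding large_def
proof
  fix n
  have "\<exists>\<^sub>\<infinity>m. s @ [m] \<in> (deriv_tree ^^ n) (inf_tree A X)"
    using assms(2) by (rule frequently_elim1) (simp add: large_def)
  then have "s \<in> (deriv_tree ^^ Suc n) (inf_tree A X)"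
    using inf_tree_closed[OF assms(1)] by (intro deriv_tree_SucI)
  then show "s \<in> (deriv_tree ^^ n) (inf_tree A X)"
    by (simp only: deriv_tree_Suc_iff)
qed

text \<open>The pigeonhole principle at each derivative shows that largeness is a partition property.\<close>

lemma deriv_tree_inf_tree_Un:
  assumes "tree_partition A" "s \<in> (deriv_tree ^^ n) (inf_tree A (X \<union> Y))"
  shows "s \<in> (deriv_tree ^^ n) (inf_tree A X) \<or> s \<in> (deriv_tree ^^ n) (inf_tree A Y)"
  using assms(2)
proof (induction n arbitrary: s)
  case 0
  then show ?case by (simp add: inf_tree_def Int_Un_distrib2)
next
  case (Suc n)
  have "\<exists>\<^sub>\<infinity>m. s @ [m] \<in> (deriv_tree ^^ n) (inf_tree A X) \<or>
                s @ [m] \<in> (deriv_tree ^^ n) (inf_tree A Y)"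
    using Suc.prems[unfolded deriv_tree_Suc_iff] Suc.IH by (blast intro: frequently_elim1)
  then have "(\<exists>\<^sub>\<infinity>m. s @ [m] \<in> (deriv_tree ^^ n) (inf_tree A X)) \<or>
             (\<exists>\<^sub>\<infinity>m. s @ [m] \<in> (deriv_tree ^^ n) (inf_tree A Y))"
    by (simp only: frequently_disj_iff)
  then show ?case
    using inf_tree_closed[OF assms(1)] deriv_tree_SucI by blast
qed

lemma large_Un:
  assumes "tree_partition A" "large A (X \<union> Y) s"
  shows "large A X s \<or> large A Y s"
proof (rule ccontr)
  assume "\<not> ?thesis"
  then obtain m n where "s \<notin> (deriv_tree ^^ m) (inf_tree A X)" "s \<notin> (deriv_tree ^^ n) (inf_tree A Y)"
    unfolding large_def by blast
  then have "s \<notin> (deriv_tree ^^ max m n) (inf_tree A X)"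
    "s \<notin> (deriv_tree ^^ max m n) (inf_tree A Y)"
    using deriv_tree_antimono[of m "max m n"] deriv_tree_antimono[of n "max m n"] by auto
  then show False
    using deriv_tree_inf_tree_Un[OF assms(1)] assms(2) unfolding large_def by blast
qed

section \<open>Almost all nodes of a level\<close>

text \<open>Almost all extensions of a node by \<open>R\<close> further entries. At the root and for \<open>R \<ge> 1\<close> this is
  the dual filter of the \<open>R\<close>-th Fubini power of the finite sets.\<close>

primrec almost_all :: "nat \<Rightarrow> (nat list \<Rightarrow> bool) \<Rightarrow> nat list \<Rightarrow> bool" where
  "almost_all 0 Q s \<longleftrightarrow> Q s"
| "almost_all (Suc R) Q s \<longleftrightarrow> (\<forall>\<^sub>\<infinity>n. almost_all R Q (s @ [n]))"

lemma almost_all_mono: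
  assumes "almost_all R Q s" "\<And>t. Q t \<Longrightarrow> Q' t"
  shows "almost_all R Q' s"
  using assms(1)
  by (induction R arbitrary: s) (auto intro: assms(2) elim: eventually_mono)

lemma almost_all_conj:
  assumes "almost_all R P s" "almost_all R Q s"
  shows "almost_all R (\<lambda>t. P t \<and> Q t) s"
  using assms
  by (induction R arbitrary: s) (auto elim: eventually_elim2)

text \<open>The recursion splits off the outermost quantifier; the induction over levels below has to
  remove the innermost one.\<close>

lemma almost_all_Suc_inner:
  "almost_all (Suc R) Q s \<longleftrightarrow> almost_all R (\<lambda>t. \<forall>\<^sub>\<infinity>n. Q (t @ [n])) s"
proof (induction R arbitrary: s)
  case (Suc R)
  show ?case
    by (subst (1) almost_all.simps(2), subst (2) almost_all.simps(2)) (simp only: Suc)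
qed simp

lemma almost_all_not_large:
  assumes "tree_partition A" "\<not> large A X s"
  shows "almost_all R (\<lambda>t. \<not> large A X t) s"
  using assms(2)
proof (induction R arbitrary: s)
  case (Suc R)
  then have "\<forall>\<^sub>\<infinity>n. \<not> large A X (s @ [n])"
    using large_if_frequently_large[OF assms(1)] by (metis not_frequently)
  then show ?case by (auto intro: Suc.IH elim: eventually_mono)
qed simp

lemma almost_all_notin_inf_tree:
  assumes "tree_partition A" "s \<notin> (deriv_tree ^^ R) (inf_tree A X)"
  shows "almost_all R (\<lambda>t. t \<notin> inf_tree A X) s"
  using assms(2)
proof (induction R arbitrary: s)
  case (Suc R)
  have "\<not> (\<exists>\<^sub>\<infinity>n. s @ [n] \<in> (deriv_tree ^^ R) (inf_tree A X))"
    using Suc.prems deriv_tree_SucI inf_tree_closed[OF assms(1)] by blast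
  then have "\<forall>\<^sub>\<infinity>n. s @ [n] \<notin> (deriv_tree ^^ R) (inf_tree A X)"
    by (simp only: not_frequently)
  then show ?case by (auto intro: Suc.IH elim: eventually_mono)
qed simp

section \<open>Settled functions\<close>

definition settled :: "(nat list \<Rightarrow> nat set) \<Rightarrow> nat \<Rightarrow> (nat \<Rightarrow> nat) \<Rightarrow> bool" where
  "settled A R c \<longleftrightarrow> almost_all R (\<lambda>t. \<exists>j. large A {x. c x < j} t) []"

text \<open>This is what makes one function \<open>h\<close> serve countably many requirements: requirement \<open>p\<close> is met
  at all arguments beyond a threshold that is known before the bound \<open>F p\<close> is chosen.\<close>

lemma exists_eventual_bound:
  fixes F :: "'a::countable \<Rightarrow> nat"
  obtains h :: "nat \<Rightarrow> nat" where "\<And>p w. to_nat p \<le> w \<Longrightarrow> F p \<le> h w"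
proof
  fix p :: 'a and w assume "to_nat p \<le> w"
  then have "F (from_nat (to_nat p)) \<le> (\<Sum>k\<le>w. F (from_nat k))"
    by (intro member_le_sum) auto
  then show "F p \<le> (\<Sum>k\<le>w. F (from_nat k))" by simp
qed

text \<open>If no set \<open>{x. c x < j}\<close> is large at \<open>t\<close>, then \<open>c\<close> is unbounded on \<open>A t\<close>. A single \<open>h\<close> makes
  \<open>{x. g x \<le> h (c x)}\<close> infinite on all cells of this kind. As this set is in
  the ideal, the root drops out of its tree at some derivative \<open>R\<close>, so almost no node of length \<open>R\<close> is
  of this kind.\<close>

lemma settled_at_some_level:
  fixes g c :: "nat \<Rightarrow> nat"
  assumes A: "tree_partition A"
    and H: "\<And>h. {x. g x \<le> h (c x)} \<in> H_limit A"
  shows "\<exists>R. settled A R c"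
proof -
  define bad where "bad t \<longleftrightarrow> (\<forall>j. \<not> large A {x. c x < j} t)" for t
  have unbounded: "\<exists>x. x \<in> A t \<and> j \<le> c x" if "bad t" for t j
  proof -
    have "{x. c x < j} \<union> {x. j \<le> c x} = UNIV" by auto
    then have "large A {x. j \<le> c x} t"
      using that large_UNIV[OF A, of t] large_Un[OF A] unfolding bad_def by metis
    from large_imp_infinite[OF this] have "{x. j \<le> c x} \<inter> A t \<noteq> {}" by (metis finite.emptyI)
    then show ?thesis by blast
  qed
  then have "\<forall>t i. \<exists>x. bad t \<longrightarrow> x \<in> A t \<and> max i (to_nat (t, i)) \<le> c x" by blast
  then obtain pt where pt: "\<And>t i. bad t \<Longrightarrow> pt t i \<in> A t \<and> max i (to_nat (t, i)) \<le> c (pt t i)"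
    by metis
  obtain h where h: "\<And>p w. to_nat p \<le> w \<Longrightarrow> g (pt (fst p) (snd p)) \<le> h w"
    using exists_eventual_bound[of "\<lambda>p::nat list \<times> nat. g (pt (fst p) (snd p))"] by blast
  define X where "X = {x. g x \<le> h (c x)}"
  have bad_infinite: "t \<in> inf_tree A X" if t: "bad t" for t
  proof -
    have mem: "pt t i \<in> X \<inter> A t" for i
      using pt[OF t, of i] h[of "(t, i)"] by (auto simp: X_def)
    \<comment> \<open>The points \<open>pt t i\<close> need not be distinct for distinct \<open>i\<close>, but \<open>c\<close> is unbounded on them.\<close>
    have "infinite (c ` (X \<inter> A t))"
      unfolding infinite_nat_iff_unbounded_le
    proof
      fix i
      show "\<exists>n\<ge>i. n \<in> c ` (X \<inter> A t)" using mem[of i] pt[OF t, of i] by auto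
    qed
    then show ?thesis unfolding inf_tree_def by auto
  qed
  have "X \<in> H_limit A" unfolding X_def by (rule H)
  then obtain R where "[] \<notin> (deriv_tree ^^ R) (inf_tree A X)"
    unfolding H_limit_def H_level_def by blast
  from almost_all_notin_inf_tree[OF A this] have "settled A R c"
    unfolding settled_def
    by (rule almost_all_mono) (use bad_infinite in \<open>auto simp: bad_def\<close>)
  then show ?thesis ..
qed

text \<open>Let \<open>t\<close> be a node at which no \<open>{x. d x < j}\<close> is large, while at almost all children of \<open>t\<close>
  some \<open>{x. c x < j}\<close> is. For any threshold \<open>m\<close>, only finitely many children have \<open>{x. d x < m}\<close> large,
  so at another child \<open>{x. c x < j \<and> m \<le> d x}\<close> is large. For each \<open>t\<close> this is done for
  infinitely many children, with thresholds that are distinct for distinct pairs of a node and an index;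
  so a single \<open>h\<close> puts all these sets into \<open>{x. c x \<le> h (d x)}\<close>, which is then large at all such \<open>t\<close>.
  Since this set is not large at the root, almost no node of length \<open>R\<close> is of this kind.\<close>

lemma settled_step:
  assumes A: "tree_partition A"
    and H: "\<And>h. {x. c x \<le> h (d x)} \<in> H_limit A"
    and c: "settled A (Suc R) c"
  shows "settled A R d"
proof -
  define bad where "bad t \<longleftrightarrow> (\<forall>j. \<not> large A {x. d x < j} t) \<and>
    (\<forall>\<^sub>\<infinity>n. \<exists>j. large A {x. c x < j} (t @ [n]))" for t
  have child: "\<exists>n C. i \<le> n \<and> large A {x. c x < C \<and> m \<le> d x} (t @ [n])" if t: "bad t" for t i m
  proof -
    have "\<not> large A {x. d x < m} t" using t unfolding bad_def by blast
    then have "\<forall>\<^sub>\<infinity>n. \<not> large A {x. d x < m} (t @ [n])"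
      using almost_all_not_large[OF A, of _ t "Suc 0"] by simp
    moreover have "\<forall>\<^sub>\<infinity>n. \<exists>j. large A {x. c x < j} (t @ [n])" using t unfolding bad_def by blast
    moreover have "\<forall>\<^sub>\<infinity>n. i \<le> n" by (auto simp: MOST_nat_le)
    ultimately have "\<forall>\<^sub>\<infinity>n. i \<le> n \<and> \<not> large A {x. d x < m} (t @ [n]) \<and>
        (\<exists>j. large A {x. c x < j} (t @ [n]))"
      by eventually_elim blast
    then obtain n C where n: "i \<le> n" "\<not> large A {x. d x < m} (t @ [n])"
      "large A {x. c x < C} (t @ [n])"
      unfolding MOST_nat_le by (meson order_refl)
    have "large A ({x. d x < m} \<union> {x. c x < C \<and> m \<le> d x}) (t @ [n])"
      using n(3) by (rule large_mono) auto
    from large_Un[OF A this] n(2) have "large A {x. c x < C \<and> m \<le> d x} (t @ [n])" by simp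
    with n(1) show ?thesis by blast
  qed
  then have "\<forall>t i. \<exists>n C. bad t \<longrightarrow>
      i \<le> n \<and> large A {x. c x < C \<and> to_nat (t, i) \<le> d x} (t @ [n])" by blast
  then obtain N C where NC: "\<And>t i. bad t \<Longrightarrow>
      i \<le> N t i \<and> large A {x. c x < C t i \<and> to_nat (t, i) \<le> d x} (t @ [N t i])"
    unfolding choice_iff by blast
  obtain h where h: "\<And>p w. to_nat p \<le> w \<Longrightarrow> C (fst p) (snd p) \<le> h w"
    using exists_eventual_bound[of "\<lambda>p::nat list \<times> nat. C (fst p) (snd p)"] by blast
  define X where "X = {x. c x \<le> h (d x)}"
  have bad_large: "large A X t" if t: "bad t" for t
  proof (rule large_if_frequently_large[OF A])
    have "large A X (t @ [N t i])" for i
    proof (rule large_mono)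
      show "large A {x. c x < C t i \<and> to_nat (t, i) \<le> d x} (t @ [N t i])" using NC[OF t] by blast
      show "{x. c x < C t i \<and> to_nat (t, i) \<le> d x} \<subseteq> X"
        using h[of "(t, i)"] by (fastforce simp: X_def)
    qed
    then show "\<exists>\<^sub>\<infinity>n. large A X (t @ [n])"
      unfolding INFM_nat_le using NC[OF t] by blast
  qed
  have "\<not> large A X []" using H unfolding X_def H_limit_iff_not_large .
  then have "almost_all R (\<lambda>t. \<not> large A X t) []" by (rule almost_all_not_large[OF A])
  moreover have "almost_all R (\<lambda>t. \<forall>\<^sub>\<infinity>n. \<exists>j. large A {x. c x < j} (t @ [n])) []"
    using c unfolding settled_def almost_all_Suc_inner .
  ultimately show ?thesis
    unfolding settled_def
    by (rule almost_all_mono[OF almost_all_conj]) (use bad_large in \<open>auto simp: bad_def\<close>)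
qed

lemma no_infinite_chain:
  fixes a :: "nat \<Rightarrow> nat \<Rightarrow> nat"
  assumes A: "tree_partition A"
    and H: "\<And>k h. {x. a k x \<le> h (a (Suc k) x)} \<in> H_limit A"
  shows False
proof -
  obtain R where R: "settled A R (a (Suc 0))"
    using settled_at_some_level[where g = "a 0" and c = "a (Suc 0)", OF A H] by blast
  have "settled A (R - i) (a (Suc i))" if "i \<le> R" for i
    using that
  proof (induction i)
    case 0
    then show ?case using R by simp
  next
    case (Suc i)
    then have "settled A (Suc (R - Suc i)) (a (Suc i))" by (simp add: Suc_diff_Suc)
    then show ?case by (rule settled_step[OF A H])
  qed
  from this[of R] obtain j where "large A {x. a (Suc R) x < j} []"
    by (auto simp: settled_def)
  then have "large A {x. a (Suc R) x \<le> j} []" by (rule large_mono) auto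
  then show False using H[of "Suc R" "\<lambda>_. j"] by (simp add: H_limit_iff_not_large)
qed

section \<open>Adjacent coordinates of a reduction\<close>

lemma empty_in_Fin_power: "{} \<in> Fin_power (Suc k)"
  by (induction k) auto

lemma bounded_head_in_Fin_power: "{t \<in> seqs (Suc k). hd t \<le> b} \<in> Fin_power (Suc k)"
proof (cases k)
  case 0
  have "{t \<in> seqs 1. hd t \<le> b} \<subseteq> (\<lambda>n. [n]) ` {..b}"
    by (auto simp: seqs_def length_Suc_conv)
  then have "finite {t \<in> seqs 1. hd t \<le> b}" by (rule finite_subset) simp
  then show ?thesis using 0 by simp
next
  case (Suc k')
  have "n \<le> b" if "{t \<in> seqs (Suc k'). n # t \<in> {t \<in> seqs (Suc k). hd t \<le> b}} \<notin> Fin_power (Suc k')" for n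
    using that empty_in_Fin_power[of k'] by (rule_tac ccontr) simp
  then show ?thesis
    using Suc by (auto intro: finite_subset[of _ "{..b}"])
qed

lemma below_graph_in_Fin_power:
  "{t \<in> seqs (Suc (Suc k)). t ! 1 \<le> h (t ! 0)} \<in> Fin_power (Suc (Suc k))"
proof -
  have "{t \<in> seqs (Suc k). n # t \<in> {t \<in> seqs (Suc (Suc k)). t ! 1 \<le> h (t ! 0)}}
      = {t \<in> seqs (Suc k). hd t \<le> h n}" for n
    by (auto simp: seqs_def length_Suc_conv)
  then show ?thesis
    using bounded_head_in_Fin_power[of k] by simp
qed

text \<open>Sequences that are too short to have coordinate \<open>k\<close> get the value 0 there; any value would do,
  as the set of all sequences of length at most \<open>k\<close> belongs to the suffix limit ideal.\<close>

definition coord_from_right :: "nat \<Rightarrow> nat list \<Rightarrow> nat" where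
  "coord_from_right k t = (if k < length t then rev t ! k else 0)"

text \<open>The base set for the suffixes of length \<open>k + 2\<close> bounds its second coordinate in terms of its
  first one and leaves the remaining \<open>k\<close> inner coordinates free.\<close>

lemma below_graph_in_Fin_omega:
  "{t \<in> Fin_omega_dom. coord_from_right k t \<le> h (coord_from_right (Suc k) t) \<or> length t < Suc (Suc k)}
    \<in> Fin_omega" (is "?M \<in> _")
proof -
  let ?B = "{t \<in> seqs (Suc (Suc k)). t ! 1 \<le> h (t ! 0)}"
  have "last_proj (Suc (Suc k)) m ` (?M \<inter> seqs m) \<subseteq> ?B" if m: "Suc (Suc k) \<le> m" for m
  proof
    fix u assume "u \<in> last_proj (Suc (Suc k)) m ` (?M \<inter> seqs m)"
    then obtain t where t: "length t = m" "coord_from_right k t \<le> h (coord_from_right (Suc k) t)"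
      and u: "u = drop (m - Suc (Suc k)) t"
      using m by (auto simp: last_proj_def seqs_def)
    have "u ! 0 = coord_from_right (Suc k) t" "u ! 1 = coord_from_right k t"
      using t(1) m by (auto simp: u coord_from_right_def rev_nth Suc_diff_Suc)
    then show "u \<in> ?B" using t m by (simp add: u seqs_def)
  qed
  then have "\<forall>m\<ge>Suc (Suc k). last_proj (Suc (Suc k)) m ` (?M \<inter> seqs m) \<subseteq> ?B" by blast
  moreover have "1 \<le> Suc (Suc k)" by simp
  ultimately have "\<exists>k\<ge>1. \<exists>B\<in>Fin_power k. \<forall>m\<ge>k. last_proj k m ` (?M \<inter> seqs m) \<subseteq> B"
    using below_graph_in_Fin_power[of k h] by blast
  moreover have "?M \<subseteq> Fin_omega_dom" by blast
  ultimately show ?thesis unfolding Fin_omega_def by blast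
qed

lemma reduction_gives_chain:
  assumes f: "f \<in> UNIV \<rightarrow> Fin_omega_dom"
    and H: "\<And>S. S \<in> Fin_omega \<Longrightarrow> f -` S \<in> H_limit A"
  shows "{x. coord_from_right k (f x) \<le> h (coord_from_right (Suc k) (f x))} \<in> H_limit A"
  using H[OF below_graph_in_Fin_omega[of k h]]
  by (rule H_limit_subset) (use f in auto)

theorem theorem4p18:
  fixes A :: "nat list \<Rightarrow> nat set"
  assumes "tree_partition A"
  shows "\<not> katetov_le Fin_omega_dom Fin_omega (UNIV :: nat set) (H_limit A)"
proof
  assume "katetov_le Fin_omega_dom Fin_omega (UNIV :: nat set) (H_limit A)"
  then obtain f where f: "f \<in> UNIV \<rightarrow> Fin_omega_dom"
    and H: "\<And>S. S \<in> Fin_omega \<Longrightarrow> f -` S \<in> H_limit A"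
    unfolding katetov_le_def by auto
  show False
    using reduction_gives_chain[OF f H] by (rule no_infinite_chain[OF assms])
qed

end
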